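(* Fix $n$. Assume that $\rho(\cdot,y)$ is convex and Lipschitz with constant $L>0$ for each $y\in\{0,1\}$, that $X_{ij}\sim Subg(\sigma_{jn}^2)$ for $j=1,\dots,p_n$, and that for some $\epsilon,\theta>0$ and for every $w\subseteq\{1,\dots,p_n\}$ with $|w|\le k_n$ the following holds: $R(b)-R(\beta^* )\ge\theta\|b-\beta^*\|_2^2$ for all $b\in\mathbb{R}^{p_n}$ such that $\operatorname{supp}b\subseteq w$ and $\|b-\beta^*\|_2\le\epsilon$. Then for any $0<r<\epsilon$, $$P\left(\min_{w\in\mathcal{M}:\,s^*\subsetneq w}GIC(w)\le GIC(s^* )\right)\le\frac{8L\sqrt{k_n}\,s_n\sqrt{\ln(p_n\vee2)}}{\sqrt n}\left(\frac{rn}{a_n}+\frac{4}{\theta r}\right).$$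
   Context: $(X,Y)$ is a random element of $\mathbb{R}^{p_n}\times\{0,1\}$ (its law may depend on $n$) and $(X_i,Y_i)$, $i=1,\dots,n$, are iid copies of it, $X_i=(X_{i1},\dots,X_{ip_n})^T$. A random variable $Z$ is $Subg(\sigma^2)$ if $E\exp(tZ)\le\exp(t^2\sigma^2/2)$ for all $t\in\mathbb{R}$. $s_n=\max_{1\le j\le p_n}\sigma_{jn}$. Standing assumption: no nontrivial linear combination of the coordinates of $X$ is almost surely constant. For $\rho:\mathbb{R}\times\{0,1\}\to\mathbb{R}$ the risk and the empirical risk are $R(b)=E\rho(b^TX,Y)$ and $R_n(b)=\frac1n\sum_{i=1}^n\rho(b^TX_i,Y_i)$, $b\in\mathbb{R}^{p_n}$. $\beta^*=\arg\min_{b\in\mathbb{R}^{p_n}}R(b)$ is assumed throughout to exist and be unique; $s^*=\operatorname{supp}\beta^*=\{i:\beta^*_i\ne0\}$. $k_n$ is a deterministic positive integer and $\mathcal{M}\subseteq2^{\{1,\dots,p_n\}}$ is an arbitrary, possibly data-dependent (random), family of subsets ("models") such that almost surely $s^*\in\mathcal{M}$ and $|w|\le k_n$ for all $w\in\mathcal{M}$. For $w\subseteq\{1,\dots,p_n\}$, $\hat\beta(w)=\arg\min\{R_n(b):b\in\mathbb{R}^{p_n},\ \operatorname{supp}b\subseteq w\}$, and $$GIC(w)=nR_n(\hat\beta(w))+a_n|w|,$$ where $a_n>0$ is a given (deterministic) penalty. The minimum over an empty set is $+\infty$. $a\vee b=\max(a,b)$. *)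

theory Defs
  imports "HOL-Probability.Probability"
begin

text \<open>Coordinates are indexed by a finite type \<open>'p\<close>, so that \<open>CARD('p)\<close> is the dimension,
  and models are elements of \<open>'p set\<close>.\<close>

definition supp :: "real ^ 'p \<Rightarrow> 'p set" where
  "supp b = {i. b $ i \<noteq> 0}"

text \<open>The parameter \<open>v\<close> is the variance proxy, i.e. \<open>\<sigma>\<^sup>2\<close>. Integrability is required explicitly
  because the Bochner integral of a non-integrable function is 0.\<close>

definition subg :: "'a measure \<Rightarrow> ('a \<Rightarrow> real) \<Rightarrow> real \<Rightarrow> bool" where
  "subg M Z v \<longleftrightarrow> Z \<in> borel_measurable M \<and>
     (\<forall>t::real. integrable M (\<lambda>\<omega>. exp (t * Z \<omega>)) \<and>
        (\<integral>\<omega>. exp (t * Z \<omega>) \<partial>M) \<le> exp (t\<^sup>2 * v / 2))"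

text \<open>The space of values of a pair \<open>(X, Y)\<close>: \<open>measurable M obs_space\<close> forces \<open>Y\<close> to be
  \<open>{0,1}\<close>-valued on \<open>space M\<close>.\<close>

definition obs_space :: "((real ^ 'p) \<times> nat) measure" where
  "obs_space = borel \<Otimes>\<^sub>M count_space {0, 1}"

definition iid_copies ::
  "'a measure \<Rightarrow> 'b measure \<Rightarrow> ('a \<Rightarrow> 'b) \<Rightarrow> (nat \<Rightarrow> 'a \<Rightarrow> 'b) \<Rightarrow> nat set \<Rightarrow> bool" where
  "iid_copies M N Z Zs I \<longleftrightarrow>
     prob_space.indep_vars M (\<lambda>_. N) Zs I \<and>
     (\<forall>i\<in>I. distr M N (Zs i) = distr M N Z)"

definition risk ::
  "'a measure \<Rightarrow> (real \<Rightarrow> nat \<Rightarrow> real) \<Rightarrow> ('a \<Rightarrow> real ^ 'p) \<Rightarrow> ('a \<Rightarrow> nat) \<Rightarrow> real ^ 'p \<Rightarrow> real" where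
  "risk M \<rho> X Y b = (\<integral>\<omega>. \<rho> (b \<bullet> X \<omega>) (Y \<omega>) \<partial>M)"

definition emp_risk ::
  "(real \<Rightarrow> nat \<Rightarrow> real) \<Rightarrow> nat \<Rightarrow> (nat \<Rightarrow> 'a \<Rightarrow> real ^ 'p) \<Rightarrow> (nat \<Rightarrow> 'a \<Rightarrow> nat)
     \<Rightarrow> 'a \<Rightarrow> real ^ 'p \<Rightarrow> real" where
  "emp_risk \<rho> n Xs Ys \<omega> b = (1 / real n) * (\<Sum>i=1..n. \<rho> (b \<bullet> Xs i \<omega>) (Ys i \<omega>))"

definition GIC ::
  "(real \<Rightarrow> nat \<Rightarrow> real) \<Rightarrow> nat \<Rightarrow> (nat \<Rightarrow> 'a \<Rightarrow> real ^ 'p) \<Rightarrow> (nat \<Rightarrow> 'a \<Rightarrow> nat) \<Rightarrow> real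
     \<Rightarrow> ('p set \<Rightarrow> 'a \<Rightarrow> real ^ 'p) \<Rightarrow> 'a \<Rightarrow> 'p set \<Rightarrow> real" where
  "GIC \<rho> n Xs Ys a \<beta>hat \<omega> w =
     real n * emp_risk \<rho> n Xs Ys \<omega> (\<beta>hat w \<omega>) + a * real (card w)"

end

theory Submission
  imports Defs
begin

text \<open>
  If \<open>GIC w \<le> GIC s*\<close> for some \<open>w\<close> strictly above \<open>s*\<close>, the empirical risk drops by at least \<open>a / n\<close>
  from \<open>\<beta>*\<close> to \<open>\<beta>hat w\<close>. Either \<open>\<beta>hat w\<close> lies within distance \<open>r\<close> of \<open>\<beta>*\<close>, or, by convexity, the
  point \<open>b\<close> of the segment from \<open>\<beta>*\<close> to \<open>\<beta>hat w\<close> at distance \<open>r\<close> satisfies \<open>R\<^sub>n b \<le> R\<^sub>n \<beta>*\<close>, while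
  \<open>R b - R \<beta>* \<ge> \<theta> r\<^sup>2\<close>. So the one-sided supremum of \<open>(R b - R \<beta>*) - (R\<^sub>n b - R\<^sub>n \<beta>*)\<close> over the sparse
  vectors \<open>b\<close> in an \<open>r\<close>-ball is at least \<open>min (a / n) (\<theta> r\<^sup>2)\<close>, and Markov's inequality applies.

  The expected supremum is bounded by replacing the centred losses one observation at a time by
  Rademacher terms \<open>\<plusminus> 2 L (b - \<beta>*) \<bullet> x\<close>. After all replacements the maximum is at most
  \<open>2 L \<kappa> max\<^sub>j \<bar>u\<^sub>j\<bar>\<close>, where \<open>\<kappa>\<close> bounds the \<open>l\<^sub>1\<close> norms of \<open>b - \<beta>*\<close>, hence at most
  \<open>(2 L \<kappa> / t) ln (\<Sum>\<^sub>j 2 cosh (t u\<^sub>j))\<close>; averaging this potential over one subgaussian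
  symmetrized observation raises the logarithm by at most \<open>t\<^sup>2 s\<^sup>2 / 2\<close>.
\<close>

section \<open>Integrability and norm preliminaries\<close>

lemma integrable_Max:
  fixes f :: "'b \<Rightarrow> 'z \<Rightarrow> real"
  assumes "finite T" "T \<noteq> {}" "\<And>b. b \<in> T \<Longrightarrow> integrable N (f b)"
  shows "integrable N (\<lambda>z. MAX b\<in>T. f b z)"
  using assms
proof (induction T rule: finite_ne_induct)
  case (insert b T)
  have "(MAX c\<in>insert b T. f c z) = max (f b z) (MAX c\<in>T. f c z)" for z
    using insert by simp
  then show ?case
    using insert by (auto intro!: integrable_max)
qed auto

text \<open>Since \<open>\<bar>y\<bar> \<le> exp y + exp (- y)\<close>, the exponential moments at 1
  and -1 dominate. This is how subgaussian coordinates get finite means.\<close>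

lemma integrable_of_exp:
  fixes f :: "'z \<Rightarrow> real"
  assumes "f \<in> borel_measurable N" "\<And>t. integrable N (\<lambda>z. exp (t * f z))"
  shows "integrable N f"
proof (rule Bochner_Integration.integrable_bound)
  show "integrable N (\<lambda>z. exp (1 * f z) + exp ((-1) * f z))"
    by (intro Bochner_Integration.integrable_add assms(2))
  have "\<bar>y\<bar> \<le> exp y + exp (- y)" for y :: real
    using exp_ge_add_one_self[of y] exp_ge_add_one_self[of "- y"]
      exp_gt_zero[of y] exp_gt_zero[of "- y"] by linarith
  then show "AE z in N. norm (f z) \<le> norm (exp (1 * f z) + exp ((-1) * f z))"
    by (auto simp: abs_of_nonneg add_nonneg_nonneg)
qed (rule assms(1))

lemma borel_measurable_component:
  "x \<in> borel_measurable N \<Longrightarrow> (\<lambda>z. x z $ j :: real) \<in> borel_measurable N"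
  by (rule measurable_compose[OF _ borel_measurable_continuous_onI]) (auto intro!: continuous_intros)

lemma ln_two_CARD_pos: "0 < ln (2 * real CARD('p :: finite))"
proof (rule ln_gt_zero)
  have "1 \<le> CARD('p)" by (simp add: Suc_le_eq)
  then show "1 < 2 * real CARD('p)" by linarith
qed

lemma abs_inner_le_l1:
  fixes u v :: "real ^ 'p"
  assumes "\<And>j. \<bar>u $ j\<bar> \<le> c"
  shows "\<bar>v \<bullet> u\<bar> \<le> (\<Sum>j\<in>UNIV. \<bar>v $ j\<bar>) * c"
proof -
  have "\<bar>v \<bullet> u\<bar> \<le> (\<Sum>j\<in>UNIV. \<bar>v $ j * u $ j\<bar>)"
    unfolding inner_vec_def by (simp add: sum_abs)
  also have "\<dots> \<le> (\<Sum>j\<in>UNIV. \<bar>v $ j\<bar> * c)"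
    using assms by (intro sum_mono) (auto simp: abs_mult intro: mult_left_mono)
  finally show ?thesis
    by (simp add: sum_distrib_right)
qed

lemma ennreal_average:
  assumes "0 \<le> p" "0 \<le> q"
  shows "ennreal ((p + q) / 2) = ennreal (1 / 2) * ennreal p + ennreal (1 / 2) * ennreal q"
proof -
  have "(p + q) / 2 = 1 / 2 * p + 1 / 2 * q" by simp
  then show ?thesis
    using assms by (simp only: ennreal_plus ennreal_mult divide_nonneg_nonneg mult_nonneg_nonneg
        zero_le_one zero_le_numeral)
qed

section \<open>The log-cosh potential\<close>

text \<open>This is the sum of \<open>exp (t * u $ j)\<close> and \<open>exp (- t * u $ j)\<close>
  over all coordinates, so \<open>ln (cosh_sum t u) / t\<close> is a soft maximum of the absolute
  coordinates. The factor 2 keeps the logarithm positive even in dimension one.\<close>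

definition cosh_sum :: "real \<Rightarrow> real ^ 'p \<Rightarrow> real" where
  "cosh_sum t u = (\<Sum>j\<in>UNIV. 2 * cosh (t * u $ j))"

lemma cosh_sum_ge: "2 * real CARD('p) \<le> cosh_sum t (u :: real ^ 'p)"
proof -
  have "(\<Sum>j\<in>(UNIV :: 'p set). 2 * 1) \<le> cosh_sum t u"
    unfolding cosh_sum_def
    by (intro sum_mono mult_left_mono) (auto simp: cosh_real_ge_1)
  then show ?thesis by simp
qed

lemma one_less_cosh_sum: "1 < cosh_sum t (u :: real ^ 'p)"
proof -
  have "1 \<le> CARD('p)" by (simp add: Suc_le_eq)
  then show ?thesis using cosh_sum_ge[of t u] by linarith
qed

lemma abs_component_le_ln_cosh_sum:
  assumes "t > 0"
  shows "\<bar>u $ j\<bar> \<le> ln (cosh_sum t u) / t"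
proof -
  have "exp \<bar>t * u $ j\<bar> \<le> exp (t * u $ j) + exp (- (t * u $ j))"
    by (cases "t * u $ j \<ge> 0") auto
  also have "\<dots> = 2 * cosh (t * u $ j)"
    by (simp add: cosh_def)
  also have "\<dots> \<le> cosh_sum t u"
    unfolding cosh_sum_def by (rule member_le_sum) auto
  finally have "\<bar>t * u $ j\<bar> \<le> ln (cosh_sum t u)"
    using one_less_cosh_sum[of t u] by (subst ln_ge_iff) auto
  then show ?thesis
    using assms by (simp add: abs_mult field_simps)
qed

text \<open>The addition formulas cancel the sinh terms. Averaging over the sign of \<open>v\<close>
  thus separates \<open>u\<close> from \<open>v\<close>, and only the mean of
  \<open>cosh (t * v $ j)\<close> has to be controlled afterwards.\<close>

lemma cosh_sum_average:
  "(cosh_sum t (u + v) + cosh_sum t (u - v)) / 2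
     = (\<Sum>j\<in>UNIV. 2 * cosh (t * u $ j) * cosh (t * v $ j))"
  unfolding cosh_sum_def sum.distrib[symmetric] sum_divide_distrib
  by (intro sum.cong) (auto simp: cosh_add cosh_diff algebra_simps)

section \<open>Expected maximum of a Lipschitz process over a finite index set\<close>

text \<open>In the application \<open>x\<close> is the covariate, \<open>\<delta> b\<close> the
  displacement from a reference vector and \<open>g b\<close> the loss increment over it. At the
  base point \<open>b0\<close> both vanish; this keeps the maxima under nonnegative integrals
  nonnegative, so that \<open>ennreal\<close> truncates nothing.\<close>

locale lipschitz_process = prob_space P for P :: "'z measure" +
  fixes x :: "'z \<Rightarrow> real ^ 'p" and T :: "'b set" and \<delta> :: "'b \<Rightarrow> real ^ 'p"
    and g :: "'b \<Rightarrow> 'z \<Rightarrow> real" and L R s :: real and b0 :: 'b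
  assumes x_measurable [measurable]: "x \<in> borel_measurable P"
    and exp_integrable: "integrable P (\<lambda>z. exp (t * x z $ j))"
    and exp_integral_le: "(\<integral>z. exp (t * x z $ j) \<partial>P) \<le> exp (t\<^sup>2 * s\<^sup>2 / 2)"
    and finite_T: "finite T"
    and base: "b0 \<in> T" "\<delta> b0 = 0" "\<And>z. g b0 z = 0"
    and g_integrable: "b \<in> T \<Longrightarrow> integrable P (g b)"
    and g_lipschitz: "b \<in> T \<Longrightarrow> b' \<in> T \<Longrightarrow> z \<in> space P \<Longrightarrow>
      g b z - g b' z \<le> L * \<bar>(\<delta> b - \<delta> b') \<bullet> x z\<bar>"
    and L_nonneg: "L \<ge> 0"
    and l1_le: "b \<in> T \<Longrightarrow> (\<Sum>j\<in>UNIV. \<bar>\<delta> b $ j\<bar>) \<le> R"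
begin

definition centred :: "'b \<Rightarrow> 'z \<Rightarrow> real" where
  "centred b z = (\<integral>z'. g b z' \<partial>P) - g b z"

lemma T_nonempty: "T \<noteq> {}"
  using base by auto

lemma centred_base [simp]: "centred b0 z = 0"
  by (simp add: centred_def base)

lemma g_measurable [measurable]: "b \<in> T \<Longrightarrow> g b \<in> borel_measurable P"
  using g_integrable by blast

lemma centred_measurable [measurable]: "b \<in> T \<Longrightarrow> centred b \<in> borel_measurable P"
  unfolding centred_def by measurable

lemma R_nonneg: "R \<ge> 0"
  using l1_le[OF base(1)] by (simp add: base)

lemma inner_integrable: "integrable P (\<lambda>z. v \<bullet> x z)"
proof -
  have "integrable P (\<lambda>z. x z $ j)" for j
    by (rule integrable_of_exp[OF borel_measurable_component[OF x_measurable] exp_integrable])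
  then show ?thesis
    unfolding inner_vec_def by (auto intro!: Bochner_Integration.integrable_sum)
qed

text \<open>Two-point contraction: let \<open>b\<close> and \<open>b'\<close> attain the two maxima
  on the left. The Lipschitz bound replaces the difference of the \<open>g\<close> values by an
  absolute linear form, and the sign of that form decides which of \<open>b\<close> and
  \<open>b'\<close> is inserted into the maximum with the plus sign and which into the
  other.\<close>

lemma contraction_pointwise:
  assumes z: "z \<in> space P"
  shows "(MAX b\<in>T. A b + 2 * g b z) + (MAX b\<in>T. A b - 2 * g b z)
    \<le> (MAX b\<in>T. A b + 2 * L * (\<delta> b \<bullet> x z)) + (MAX b\<in>T. A b - 2 * L * (\<delta> b \<bullet> x z))"
    (is "?m1 + ?m2 \<le> ?m3 + ?m4")
proof -
  have "?m1 \<in> (\<lambda>b. A b + 2 * g b z) ` T" "?m2 \<in> (\<lambda>b. A b - 2 * g b z) ` T"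
    using finite_T T_nonempty by (auto intro!: Max_in simp del: Max_in)
  then obtain b b' where b: "b \<in> T" "?m1 = A b + 2 * g b z"
    and b': "b' \<in> T" "?m2 = A b' - 2 * g b' z"
    by blast
  have "?m1 + ?m2 = A b + A b' + 2 * (g b z - g b' z)"
    using b b' by simp
  also have "\<dots> \<le> A b + A b' + 2 * (L * \<bar>(\<delta> b - \<delta> b') \<bullet> x z\<bar>)"
    using g_lipschitz[OF b(1) b'(1) z] by simp
  also have "\<dots> \<le> ?m3 + ?m4"
  proof -
    have m3: "A c + 2 * L * (\<delta> c \<bullet> x z) \<le> ?m3" if "c \<in> T" for c
      using finite_T that by (auto intro!: Max_ge)
    have m4: "A c - 2 * L * (\<delta> c \<bullet> x z) \<le> ?m4" if "c \<in> T" for c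
      using finite_T that by (auto intro!: Max_ge)
    show ?thesis
      using m3[OF b(1)] m4[OF b(1)] m3[OF b'(1)] m4[OF b'(1)]
      by (cases "(\<delta> b - \<delta> b') \<bullet> x z \<ge> 0") (auto simp: inner_diff_left algebra_simps abs_if)
  qed
  finally show ?thesis .
qed

text \<open>Symmetrization and contraction of a single observation. No ghost sample is needed: by convexity
  of the maximum, \<open>A + E g - g z\<close> is the average of \<open>A + 2 E g\<close> and \<open>A - 2 g z\<close>.\<close>

lemma contraction_step:
  assumes A0: "A b0 \<ge> 0"
  shows "(\<integral>\<^sup>+z. ennreal (MAX b\<in>T. A b + centred b z) \<partial>P)
    \<le> (\<integral>\<^sup>+z. ennreal (((MAX b\<in>T. A b + 2 * L * (\<delta> b \<bullet> x z)) +
                       (MAX b\<in>T. A b - 2 * L * (\<delta> b \<bullet> x z))) / 2) \<partial>P)"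
proof -
  note Max_int = integrable_Max[OF finite_T T_nonempty]
  have nonneg: "0 \<le> (MAX b\<in>T. A b + f b)" if "f b0 = 0" for f
  proof -
    have "A b0 + f b0 \<le> (MAX b\<in>T. A b + f b)"
      using finite_T base(1) by (intro Max_ge) auto
    then show ?thesis using A0 that by simp
  qed
  have int1: "integrable P (\<lambda>z. MAX b\<in>T. A b + 2 * g b z)"
    and int2: "integrable P (\<lambda>z. MAX b\<in>T. A b - 2 * g b z)"
    and int3: "integrable P (\<lambda>z. MAX b\<in>T. A b + 2 * L * (\<delta> b \<bullet> x z))"
    and int4: "integrable P (\<lambda>z. MAX b\<in>T. A b - 2 * L * (\<delta> b \<bullet> x z))"
    and int5: "integrable P (\<lambda>z. MAX b\<in>T. A b + centred b z)"
    by (auto intro!: Max_int g_integrable inner_integrable simp: centred_def)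
  \<comment> \<open>Jensen for the maximum. After it both maxima are evaluated at the same
    observation \<open>z\<close>, as the pointwise contraction requires.\<close>
  have E: "(MAX b\<in>T. A b + 2 * (\<integral>z. g b z \<partial>P)) \<le> (\<integral>z. (MAX b\<in>T. A b + 2 * g b z) \<partial>P)"
  proof (rule Max.boundedI)
    show "c \<le> (\<integral>z. (MAX b\<in>T. A b + 2 * g b z) \<partial>P)"
      if c: "c \<in> (\<lambda>b. A b + 2 * (\<integral>z. g b z \<partial>P)) ` T" for c
    proof -
      obtain b where b: "b \<in> T" "c = A b + 2 * (\<integral>z. g b z \<partial>P)"
        using c by blast
      have "c = (\<integral>z. A b + 2 * g b z \<partial>P)"
        using b g_integrable[OF b(1)] by (simp add: prob_space)
      also have "\<dots> \<le> (\<integral>z. (MAX b\<in>T. A b + 2 * g b z) \<partial>P)"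
        using b finite_T g_integrable[OF b(1)]
        by (intro integral_mono int1) (auto intro!: Max_ge)
      finally show ?thesis .
    qed
  qed (use finite_T T_nonempty in auto)
  have split: "(MAX b\<in>T. A b + centred b z)
      \<le> ((MAX b\<in>T. A b + 2 * (\<integral>z. g b z \<partial>P)) + (MAX b\<in>T. A b - 2 * g b z)) / 2" for z
  proof (rule Max.boundedI)
    show "c \<le> ((MAX b\<in>T. A b + 2 * (\<integral>z. g b z \<partial>P)) + (MAX b\<in>T. A b - 2 * g b z)) / 2"
      if c: "c \<in> (\<lambda>b. A b + centred b z) ` T" for c
    proof -
      obtain b where b: "b \<in> T" "c = A b + centred b z"
        using c by blast
      have "A b + 2 * (\<integral>z. g b z \<partial>P) \<le> (MAX b\<in>T. A b + 2 * (\<integral>z. g b z \<partial>P))"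
        "A b - 2 * g b z \<le> (MAX b\<in>T. A b - 2 * g b z)"
        using b finite_T by (auto intro!: Max_ge)
      then show ?thesis
        unfolding b(2) centred_def by argo
    qed
  qed (use finite_T T_nonempty in auto)
  have "(\<integral>z. (MAX b\<in>T. A b + centred b z) \<partial>P)
      \<le> (\<integral>z. ((MAX b\<in>T. A b + 2 * (\<integral>z. g b z \<partial>P)) + (MAX b\<in>T. A b - 2 * g b z)) / 2 \<partial>P)"
    using int5 int2 split by (intro integral_mono) auto
  also have "\<dots> \<le> (\<integral>z. ((MAX b\<in>T. A b + 2 * g b z) + (MAX b\<in>T. A b - 2 * g b z)) / 2 \<partial>P)"
    using E int1 int2 by (simp add: prob_space)
  also have "\<dots> \<le> (\<integral>z. ((MAX b\<in>T. A b + 2 * L * (\<delta> b \<bullet> x z)) +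
                       (MAX b\<in>T. A b - 2 * L * (\<delta> b \<bullet> x z))) / 2 \<partial>P)"
    using int1 int2 int3 int4
    by (intro integral_mono divide_right_mono contraction_pointwise) auto
  finally have "(\<integral>z. (MAX b\<in>T. A b + centred b z) \<partial>P) \<le> \<dots>" .
  moreover have "0 \<le> (MAX b\<in>T. A b - 2 * L * (\<delta> b \<bullet> x z))"
    "0 \<le> (MAX b\<in>T. A b + 2 * L * (\<delta> b \<bullet> x z))"
    "0 \<le> (MAX b\<in>T. A b + centred b z)" for z
    using nonneg[of "\<lambda>b. - 2 * L * (\<delta> b \<bullet> x z)"] nonneg[of "\<lambda>b. 2 * L * (\<delta> b \<bullet> x z)"]
      nonneg[of "\<lambda>b. centred b z"] by (auto simp: base)
  ultimately show ?thesis
    using int3 int4 int5 by (subst (1 2) nn_integral_eq_integral) (auto intro!: ennreal_leI)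
qed

text \<open>Jensen for the logarithm, done by hand: bounding \<open>ln\<close> by its tangent at
  \<open>D\<close> leaves an expression linear in the sign-averaged \<open>cosh_sum\<close>, whose
  mean is at most \<open>D\<close> by the subgaussian bound at \<open>t\<close> and
  \<open>- t\<close>. The offset \<open>d\<close> carries the cost of the other observations through
  the step.\<close>

lemma potential_step:
  assumes K: "K \<ge> 0" and d: "d \<ge> 0"
  shows "(\<integral>\<^sup>+z. ennreal (K * ((ln (cosh_sum t (u + x z)) + ln (cosh_sum t (u - x z))) / 2 + d)) \<partial>P)
    \<le> ennreal (K * (ln (cosh_sum t u) + t\<^sup>2 * s\<^sup>2 / 2 + d))"
proof -
  define D where "D = cosh_sum t u * exp (t\<^sup>2 * s\<^sup>2 / 2)"
  have D: "D > 0"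
    using one_less_cosh_sum[of t u] by (simp add: D_def)
  have lnD: "ln D = ln (cosh_sum t u) + t\<^sup>2 * s\<^sup>2 / 2"
    using one_less_cosh_sum[of t u] by (simp add: D_def ln_mult)
  define h where "h z = (\<Sum>j\<in>UNIV. 2 * cosh (t * u $ j) * cosh (t * x z $ j))" for z
  have cosh_eq: "cosh (t * x z $ j) = (exp (t * x z $ j) + exp ((- t) * x z $ j)) / 2" for z j
    by (simp add: cosh_def)
  have int_cosh: "integrable P (\<lambda>z. cosh (t * x z $ j))" for j
    unfolding cosh_eq using exp_integrable[of t j] exp_integrable[of "- t" j] by auto
  have "(\<integral>z. cosh (t * x z $ j) \<partial>P) \<le> exp (t\<^sup>2 * s\<^sup>2 / 2)" for j
    unfolding cosh_eq
    using exp_integrable[of t j] exp_integrable[of "- t" j]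
      exp_integral_le[of t j] exp_integral_le[of "- t" j] by simp
  then have "(\<integral>z. h z \<partial>P) \<le> (\<Sum>j\<in>UNIV. 2 * cosh (t * u $ j) * exp (t\<^sup>2 * s\<^sup>2 / 2))"
    unfolding h_def using int_cosh by (auto simp: intro!: sum_mono)
  then have h_le: "(\<integral>z. h z \<partial>P) \<le> D"
    by (simp add: D_def cosh_sum_def sum_distrib_right)
  have int_h: "integrable P h"
    unfolding h_def using int_cosh by auto
  have ln_le: "ln y \<le> ln D + (y / D - 1)" if "y > 0" for y
    using ln_le_minus_one[of "y / D"] that D by (simp add: ln_div)
  have pointwise: "K * ((ln (cosh_sum t (u + x z)) + ln (cosh_sum t (u - x z))) / 2 + d)
      \<le> K * (ln D + d + (h z / D - 1))" for z
  proof (intro mult_left_mono K)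
    have "cosh_sum t (u + x z) > 0" "cosh_sum t (u - x z) > 0"
      using one_less_cosh_sum[of t "u + x z"] one_less_cosh_sum[of t "u - x z"] by linarith+
    then have "(ln (cosh_sum t (u + x z)) + ln (cosh_sum t (u - x z))) / 2
        \<le> ((ln D + (cosh_sum t (u + x z) / D - 1)) + (ln D + (cosh_sum t (u - x z) / D - 1))) / 2"
      using ln_le[of "cosh_sum t (u + x z)"] ln_le[of "cosh_sum t (u - x z)"] by argo
    also have "\<dots> = ln D + ((cosh_sum t (u + x z) + cosh_sum t (u - x z)) / 2 / D - 1)"
      by (simp add: add_divide_distrib diff_divide_distrib mult.commute)
    finally show "(ln (cosh_sum t (u + x z)) + ln (cosh_sum t (u - x z))) / 2 + d
        \<le> ln D + d + (h z / D - 1)"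
      unfolding cosh_sum_average h_def by simp
  qed
  have nonneg: "0 \<le> K * ((ln (cosh_sum t (u + x z)) + ln (cosh_sum t (u - x z))) / 2 + d)" for z
    using one_less_cosh_sum[of t "u + x z"] one_less_cosh_sum[of t "u - x z"] K d
    by (intro mult_nonneg_nonneg add_nonneg_nonneg) auto
  have "(\<integral>\<^sup>+z. ennreal (K * ((ln (cosh_sum t (u + x z)) + ln (cosh_sum t (u - x z))) / 2 + d)) \<partial>P)
      \<le> (\<integral>\<^sup>+z. ennreal (K * (ln D + d + (h z / D - 1))) \<partial>P)"
    by (intro nn_integral_mono ennreal_leI pointwise)
  also have "\<dots> = ennreal (\<integral>z. K * (ln D + d + (h z / D - 1)) \<partial>P)"
    using int_h order_trans[OF nonneg pointwise] by (intro nn_integral_eq_integral) auto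
  also have "(\<integral>z. K * (ln D + d + (h z / D - 1)) \<partial>P) = K * (ln D + d + ((\<integral>z. h z \<partial>P) / D - 1))"
    using int_h by (simp add: prob_space)
  also have "ennreal \<dots> \<le> ennreal (K * (ln D + d))"
    using h_le D K by (intro ennreal_leI mult_left_mono) auto
  finally show ?thesis
    by (simp add: lnD add_ac)
qed

text \<open>Induction over the observations not yet replaced. The vector \<open>u\<close> stands for
  the signed sum of those already replaced; it must be arbitrary because the induction hypothesis is
  used at \<open>u + x z\<close> and \<open>u - x z\<close>.\<close>

lemma expectation_Max_le_potential:
  assumes "finite I" and t: "t > 0"
  shows "(\<integral>\<^sup>+\<omega>. ennreal (MAX b\<in>T. 2 * L * (\<delta> b \<bullet> u) + (\<Sum>i\<in>I. centred b (\<omega> i))) \<partial>(\<Pi>\<^sub>M i\<in>I. P))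
    \<le> ennreal (2 * L * R / t * (ln (cosh_sum t u) + real (card I) * (t\<^sup>2 * s\<^sup>2 / 2)))"
  using assms(1)
proof (induction I arbitrary: u rule: finite_induct)
  case empty
  interpret E: prob_space "\<Pi>\<^sub>M i\<in>{}. P"
    by (intro prob_space_PiM prob_space_axioms)
  \<comment> \<open>With no observations left, the linear form is at most the l1 norm times the
    largest absolute coordinate, which the soft maximum dominates.\<close>
  have "(MAX b\<in>T. 2 * L * (\<delta> b \<bullet> u)) \<le> 2 * L * R / t * ln (cosh_sum t u)"
  proof (rule Max.boundedI)
    fix c assume "c \<in> (\<lambda>b. 2 * L * (\<delta> b \<bullet> u)) ` T"
    then obtain b where b: "b \<in> T" "c = 2 * L * (\<delta> b \<bullet> u)" by blast
    have "\<delta> b \<bullet> u \<le> (\<Sum>j\<in>UNIV. \<bar>\<delta> b $ j\<bar>) * (ln (cosh_sum t u) / t)"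
      using abs_inner_le_l1[of u "ln (cosh_sum t u) / t" "\<delta> b"] abs_component_le_ln_cosh_sum[OF t]
      by (meson abs_le_D1)
    also have "\<dots> \<le> R * (ln (cosh_sum t u) / t)"
      using l1_le[OF b(1)] one_less_cosh_sum[of t u] t by (intro mult_right_mono) auto
    finally show "c \<le> 2 * L * R / t * ln (cosh_sum t u)"
      using L_nonneg b(2) mult_left_mono[of "\<delta> b \<bullet> u" "R * (ln (cosh_sum t u) / t)" "2 * L"]
      by (simp add: mult_ac)
  qed (use finite_T T_nonempty in auto)
  then show ?case
    by (simp add: E.emeasure_space_1 ennreal_leI)
next
  case (insert i I)
  interpret product_sigma_finite "\<lambda>_. P"
    by standard
  interpret J: prob_space "\<Pi>\<^sub>M i\<in>I. P"
    by (intro prob_space_PiM prob_space_axioms)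
  interpret PJ: pair_sigma_finite "\<Pi>\<^sub>M i\<in>I. P" P
    by standard
  define A where "A \<omega> b = 2 * L * (\<delta> b \<bullet> u) + (\<Sum>i\<in>I. centred b (\<omega> i))" for \<omega> b
  define K where "K = 2 * L * R / t"
  define d where "d = real (card I) * (t\<^sup>2 * s\<^sup>2 / 2)"
  have K: "K \<ge> 0" and d: "d \<ge> 0"
    using L_nonneg R_nonneg t by (auto simp: K_def d_def)
  \<comment> \<open>\<open>W\<close> at \<open>u + x z\<close> and \<open>u - x z\<close> is the
    maximum in which the observation \<open>z\<close> has moved from the centred sum into the linear
    term.\<close>
  define W where "W v \<omega> = (MAX b\<in>T. 2 * L * (\<delta> b \<bullet> v) + (\<Sum>i\<in>I. centred b (\<omega> i)))" for v \<omega>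
  have W_eq: "(MAX b\<in>T. A \<omega> b + 2 * L * (\<delta> b \<bullet> v)) = W (u + v) \<omega>"
    "(MAX b\<in>T. A \<omega> b - 2 * L * (\<delta> b \<bullet> v)) = W (u - v) \<omega>" for v \<omega>
    unfolding W_def A_def by (simp_all add: inner_add_right inner_diff_right algebra_simps)
  have W_nonneg: "0 \<le> W v \<omega>" for v \<omega>
    unfolding W_def using finite_T base
    by (intro Max_ge) (auto intro!: image_eqI[where x = b0])
  have W_measurable [measurable]: "W v \<in> borel_measurable (\<Pi>\<^sub>M i\<in>I. P)" for v
    unfolding W_def using finite_T by measurable
  have W_measurable2 [measurable]:
    "(\<lambda>(\<omega>, z). W (u + x z) \<omega>) \<in> borel_measurable ((\<Pi>\<^sub>M i\<in>I. P) \<Otimes>\<^sub>M P)"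
    "(\<lambda>(\<omega>, z). W (u - x z) \<omega>) \<in> borel_measurable ((\<Pi>\<^sub>M i\<in>I. P) \<Otimes>\<^sub>M P)"
    unfolding W_def split_def using finite_T by measurable
  have IH: "(\<integral>\<^sup>+\<omega>. ennreal (W v \<omega>) \<partial>(\<Pi>\<^sub>M i\<in>I. P)) \<le> ennreal (K * (ln (cosh_sum t v) + d))" for v
    using insert.IH[of v] by (simp add: W_def K_def d_def)
  have "(\<integral>\<^sup>+\<omega>. ennreal (MAX b\<in>T. 2 * L * (\<delta> b \<bullet> u) + (\<Sum>k\<in>insert i I. centred b (\<omega> k)))
          \<partial>(\<Pi>\<^sub>M i\<in>insert i I. P))
      = (\<integral>\<^sup>+\<omega>. (\<integral>\<^sup>+z. ennreal (MAX b\<in>T. 2 * L * (\<delta> b \<bullet> u) +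
          (\<Sum>k\<in>insert i I. centred b (fun_upd \<omega> i z k))) \<partial>P) \<partial>(\<Pi>\<^sub>M i\<in>I. P))"
    using insert.hyps finite_T by (intro product_nn_integral_insert) measurable
  also have "\<dots> = (\<integral>\<^sup>+\<omega>. (\<integral>\<^sup>+z. ennreal (MAX b\<in>T. A \<omega> b + centred b z) \<partial>P) \<partial>(\<Pi>\<^sub>M i\<in>I. P))"
  proof -
    have "(\<Sum>k\<in>insert i I. centred b (fun_upd \<omega> i z k)) = (\<Sum>k\<in>I. centred b (\<omega> k)) + centred b z"
      for b \<omega> z
    proof -
      have "(\<Sum>k\<in>I. centred b (fun_upd \<omega> i z k)) = (\<Sum>k\<in>I. centred b (\<omega> k))"
        using insert.hyps by (intro sum.cong) auto
      then show ?thesis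
        using insert.hyps by simp
    qed
    then show ?thesis
      unfolding A_def by (simp add: add.assoc)
  qed
  also have "\<dots> \<le> (\<integral>\<^sup>+\<omega>. (\<integral>\<^sup>+z. ennreal ((W (u + x z) \<omega> + W (u - x z) \<omega>) / 2) \<partial>P) \<partial>(\<Pi>\<^sub>M i\<in>I. P))"
    unfolding W_eq[symmetric]
    by (intro nn_integral_mono contraction_step) (simp add: A_def base)
  \<comment> \<open>The exchange puts the integral over the remaining observations inside, so that
    the induction hypothesis applies with \<open>z\<close> fixed.\<close>
  also have "\<dots> = (\<integral>\<^sup>+z. (\<integral>\<^sup>+\<omega>. ennreal ((W (u + x z) \<omega> + W (u - x z) \<omega>) / 2) \<partial>(\<Pi>\<^sub>M i\<in>I. P)) \<partial>P)"
    by (intro PJ.Fubini'[symmetric]) measurable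
  also have "\<dots> \<le> (\<integral>\<^sup>+z. ennreal (K * ((ln (cosh_sum t (u + x z)) + ln (cosh_sum t (u - x z))) / 2 + d)) \<partial>P)"
  proof (intro nn_integral_mono)
    fix z
    have "(\<integral>\<^sup>+\<omega>. ennreal ((W (u + x z) \<omega> + W (u - x z) \<omega>) / 2) \<partial>(\<Pi>\<^sub>M i\<in>I. P))
        = (\<integral>\<^sup>+\<omega>. ennreal (1/2) * ennreal (W (u + x z) \<omega>) + ennreal (1/2) * ennreal (W (u - x z) \<omega>)
            \<partial>(\<Pi>\<^sub>M i\<in>I. P))"
      by (intro nn_integral_cong ennreal_average W_nonneg)
    also have "\<dots> = ennreal (1/2) * (\<integral>\<^sup>+\<omega>. ennreal (W (u + x z) \<omega>) \<partial>(\<Pi>\<^sub>M i\<in>I. P))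
        + ennreal (1/2) * (\<integral>\<^sup>+\<omega>. ennreal (W (u - x z) \<omega>) \<partial>(\<Pi>\<^sub>M i\<in>I. P))"
      by (subst nn_integral_add) (auto simp: nn_integral_cmult)
    also have "\<dots> \<le> ennreal (1/2) * ennreal (K * (ln (cosh_sum t (u + x z)) + d))
        + ennreal (1/2) * ennreal (K * (ln (cosh_sum t (u - x z)) + d))"
      by (intro add_mono mult_left_mono IH) auto
    also have "\<dots> = ennreal (K * ((ln (cosh_sum t (u + x z)) + ln (cosh_sum t (u - x z))) / 2 + d))"
    proof -
      have "0 \<le> K * (ln (cosh_sum t v) + d)" for v :: "real ^ 'p"
        using one_less_cosh_sum[of t v] K d by (intro mult_nonneg_nonneg) auto
      then show ?thesis
        by (subst ennreal_average[symmetric]) (simp_all add: field_simps)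
    qed
    finally show "(\<integral>\<^sup>+\<omega>. ennreal ((W (u + x z) \<omega> + W (u - x z) \<omega>) / 2) \<partial>(\<Pi>\<^sub>M i\<in>I. P))
      \<le> ennreal (K * ((ln (cosh_sum t (u + x z)) + ln (cosh_sum t (u - x z))) / 2 + d))" .
  qed
  also have "\<dots> \<le> ennreal (K * (ln (cosh_sum t u) + t\<^sup>2 * s\<^sup>2 / 2 + d))"
    by (intro potential_step K d)
  also have "ln (cosh_sum t u) + t\<^sup>2 * s\<^sup>2 / 2 + d
      = ln (cosh_sum t u) + real (card (insert i I)) * (t\<^sup>2 * s\<^sup>2 / 2)"
    using insert.hyps by (simp add: d_def distrib_right add_divide_distrib)
  also note K_def
  finally show ?case .
qed

lemma expectation_Max_le:
  assumes "finite I" "I \<noteq> {}" "s > 0"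
  shows "(\<integral>\<^sup>+\<omega>. ennreal (MAX b\<in>T. \<Sum>i\<in>I. centred b (\<omega> i)) \<partial>(\<Pi>\<^sub>M i\<in>I. P))
    \<le> ennreal (2 * L * R * s * sqrt (2 * real (card I) * ln (2 * real CARD('p))))"
proof -
  define m where "m = real (card I)"
  define l where "l = ln (2 * real CARD('p))"
  \<comment> \<open>This \<open>t\<close> minimizes \<open>l / t + m * t * s\<^sup>2 / 2\<close>,
    making both terms equal. The potential is started at 0, where \<open>cosh_sum\<close> is
    \<open>2 * CARD('p)\<close>.\<close>
  define t where "t = sqrt (2 * l / m) / s"
  have m: "m > 0"
    using assms by (simp add: m_def card_gt_0_iff)
  have l: "l > 0"
    unfolding l_def by (rule ln_two_CARD_pos)
  have t: "t > 0"
    using m l assms by (simp add: t_def)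
  have "t\<^sup>2 * s\<^sup>2 = 2 * l / m"
    using m l assms by (simp add: t_def power_divide)
  then have "2 * L * R / t * (l + m * (t\<^sup>2 * s\<^sup>2 / 2)) = 2 * L * R * (2 * l / t)"
    using m by simp
  also have "2 * l / t = s * sqrt (2 * m * l)"
  proof -
    have "sqrt (2 * m * l) * sqrt (2 * l / m) = sqrt ((2 * l)\<^sup>2)"
      unfolding real_sqrt_mult[symmetric] using m by (simp add: power2_eq_square)
    also have "\<dots> = 2 * l"
      using l by (subst real_sqrt_abs) simp
    finally have "sqrt (2 * m * l) * sqrt (2 * l / m) = 2 * l" .
    then have "s * sqrt (2 * m * l) * t = 2 * l"
      using assms by (simp add: t_def)
    then show ?thesis
      using t by (simp add: field_simps)
  qed
  finally have "2 * L * R / t * (l + m * (t\<^sup>2 * s\<^sup>2 / 2)) = 2 * L * R * s * sqrt (2 * m * l)"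
    by simp
  then show ?thesis
    using expectation_Max_le_potential[OF assms(1) t, of 0]
    by (simp add: cosh_sum_def m_def l_def mult_ac)
qed

end

section \<open>The regression sample and its centred empirical process\<close>

lemma space_obs_space: "space (obs_space :: ((real ^ 'p) \<times> nat) measure) = UNIV \<times> {0, 1}"
  by (simp add: obs_space_def space_pair_measure)

lemma fst_measurable_obs_space [measurable]: "fst \<in> borel_measurable obs_space"
  by (simp add: obs_space_def)

locale regression_sample = prob_space M for M :: "'a measure" +
  fixes X :: "'a \<Rightarrow> real ^ 'p" and Y :: "'a \<Rightarrow> nat"
    and Xs :: "nat \<Rightarrow> 'a \<Rightarrow> real ^ 'p" and Ys :: "nat \<Rightarrow> 'a \<Rightarrow> nat"
    and \<rho> :: "real \<Rightarrow> nat \<Rightarrow> real" and n :: nat and L s :: real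
  assumes n_pos: "n \<ge> 1"
    and rv: "(\<lambda>\<omega>. (X \<omega>, Y \<omega>)) \<in> measurable M obs_space"
    and iid: "iid_copies M obs_space (\<lambda>\<omega>. (X \<omega>, Y \<omega>)) (\<lambda>i \<omega>. (Xs i \<omega>, Ys i \<omega>)) {1..n}"
    and loss_lipschitz: "y \<in> {0, 1} \<Longrightarrow> L-lipschitz_on UNIV (\<lambda>t. \<rho> t y)"
    and exp_integrable: "integrable M (\<lambda>\<omega>. exp (t * X \<omega> $ j))"
    and exp_integral_le: "(\<integral>\<omega>. exp (t * X \<omega> $ j) \<partial>M) \<le> exp (t\<^sup>2 * s\<^sup>2 / 2)"
    and s_nonneg: "s \<ge> 0"
begin

text \<open>The sign makes \<open>gap\<close> positive when the empirical risk increases less than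
  the risk does. Multiplied by \<open>n\<close>, it is the sum of the centred loss increments of the
  sample.\<close>

definition gap :: "real ^ 'p \<Rightarrow> 'a \<Rightarrow> real ^ 'p \<Rightarrow> real" where
  "gap \<beta> \<omega> b = (risk M \<rho> X Y b - risk M \<rho> X Y \<beta>)
    - (emp_risk \<rho> n Xs Ys \<omega> b - emp_risk \<rho> n Xs Ys \<omega> \<beta>)"

lemma gap_self [simp]: "gap \<beta> \<omega> \<beta> = 0"
  by (simp add: gap_def)

lemma L_nonneg: "L \<ge> 0"
  using lipschitz_on_nonneg[OF loss_lipschitz[of 0]] by simp

lemma Y_cases: "\<omega> \<in> space M \<Longrightarrow> Y \<omega> \<in> {0, 1}"
  using measurable_space[OF rv] by (simp add: space_obs_space)

lemma X_measurable [measurable]: "X \<in> borel_measurable M"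
  using measurable_compose[OF rv fst_measurable_obs_space] by simp

lemma Zs_measurable: "i \<in> {1..n} \<Longrightarrow> (\<lambda>\<omega>. (Xs i \<omega>, Ys i \<omega>)) \<in> measurable M obs_space"
  using iid unfolding iid_copies_def indep_vars_def by blast

lemma Ys_cases: "i \<in> {1..n} \<Longrightarrow> \<omega> \<in> space M \<Longrightarrow> Ys i \<omega> \<in> {0, 1}"
  using measurable_space[OF Zs_measurable] by (fastforce simp: space_obs_space)

lemma loss_diff_le:
  assumes "y \<in> {0, 1}"
  shows "\<bar>\<rho> t y - \<rho> t' y\<bar> \<le> L * \<bar>t - t'\<bar>"
  using lipschitz_on_normD[OF loss_lipschitz[OF assms], of t t'] by simp

lemma loss_continuous: "y \<in> {0, 1} \<Longrightarrow> continuous_on UNIV (\<lambda>t. \<rho> t y)"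
  using lipschitz_on_continuous_on[OF loss_lipschitz] .

text \<open>The label takes only the values 0 and 1 on the space, so the loss is a case distinction
  between two continuous functions of \<open>b \<bullet> fst z\<close>.\<close>

lemma loss_measurable: "(\<lambda>z. \<rho> (b \<bullet> fst z) (snd z)) \<in> borel_measurable obs_space"
proof -
  have [measurable]: "(\<lambda>t. \<rho> t 0) \<in> borel_measurable borel" "(\<lambda>t. \<rho> t 1) \<in> borel_measurable borel"
    using loss_continuous[of 0] loss_continuous[of 1]
    by (auto intro: borel_measurable_continuous_onI)
  have "(\<lambda>z. if snd z = 0 then \<rho> (b \<bullet> fst z) 0 else \<rho> (b \<bullet> fst z) 1) \<in> borel_measurable obs_space"
    unfolding obs_space_def by measurable
  then show ?thesis
    by (subst measurable_cong[where g = "\<lambda>z. if snd z = 0 then \<rho> (b \<bullet> fst z) 0 else \<rho> (b \<bullet> fst z) 1"])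
      (auto simp: space_obs_space)
qed

lemma component_integrable: "integrable M (\<lambda>\<omega>. X \<omega> $ j)"
  by (rule integrable_of_exp[OF borel_measurable_component[OF X_measurable] exp_integrable])

lemma norm_integrable: "integrable M (\<lambda>\<omega>. norm (X \<omega>))"
proof (rule Bochner_Integration.integrable_bound)
  show "integrable M (\<lambda>\<omega>. \<Sum>j\<in>UNIV. \<bar>X \<omega> $ j\<bar>)"
    by (intro Bochner_Integration.integrable_sum integrable_abs component_integrable)
  show "AE \<omega> in M. norm (norm (X \<omega>)) \<le> norm (\<Sum>j\<in>UNIV. \<bar>X \<omega> $ j\<bar>)"
    using norm_le_l1_cart by (auto simp: abs_of_nonneg sum_nonneg)
qed measurable

lemma inner_integrable: "integrable M (\<lambda>\<omega>. b \<bullet> X \<omega>)"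
  unfolding inner_vec_def by (auto intro!: Bochner_Integration.integrable_sum component_integrable)

lemma loss_integrable: "integrable M (\<lambda>\<omega>. \<rho> (b \<bullet> X \<omega>) (Y \<omega>))"
proof (rule Bochner_Integration.integrable_bound)
  show "integrable M (\<lambda>\<omega>. (\<bar>\<rho> 0 0\<bar> + \<bar>\<rho> 0 1\<bar>) + L * \<bar>b \<bullet> X \<omega>\<bar>)"
    using inner_integrable by auto
  show "AE \<omega> in M. norm (\<rho> (b \<bullet> X \<omega>) (Y \<omega>)) \<le> norm ((\<bar>\<rho> 0 0\<bar> + \<bar>\<rho> 0 1\<bar>) + L * \<bar>b \<bullet> X \<omega>\<bar>)"
  proof (rule AE_I2)
    fix \<omega> assume "\<omega> \<in> space M"
    then have Y: "Y \<omega> \<in> {0, 1}" by (rule Y_cases)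
    then have "\<bar>\<rho> 0 (Y \<omega>)\<bar> \<le> \<bar>\<rho> 0 0\<bar> + \<bar>\<rho> 0 1\<bar>" by auto
    then show "norm (\<rho> (b \<bullet> X \<omega>) (Y \<omega>)) \<le> norm ((\<bar>\<rho> 0 0\<bar> + \<bar>\<rho> 0 1\<bar>) + L * \<bar>b \<bullet> X \<omega>\<bar>)"
      using loss_diff_le[OF Y, of "b \<bullet> X \<omega>" 0] by simp
  qed
  show "(\<lambda>\<omega>. \<rho> (b \<bullet> X \<omega>) (Y \<omega>)) \<in> borel_measurable M"
    using measurable_compose[OF rv loss_measurable] by simp
qed

lemma risk_lipschitz: "(L * (\<integral>\<omega>. norm (X \<omega>) \<partial>M))-lipschitz_on UNIV (risk M \<rho> X Y)"
proof (rule lipschitz_onI)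
  fix b b' :: "real ^ 'p"
  have "dist (risk M \<rho> X Y b) (risk M \<rho> X Y b')
      = \<bar>\<integral>\<omega>. \<rho> (b \<bullet> X \<omega>) (Y \<omega>) - \<rho> (b' \<bullet> X \<omega>) (Y \<omega>) \<partial>M\<bar>"
    unfolding risk_def dist_real_def using loss_integrable by simp
  also have "\<dots> \<le> (\<integral>\<omega>. \<bar>\<rho> (b \<bullet> X \<omega>) (Y \<omega>) - \<rho> (b' \<bullet> X \<omega>) (Y \<omega>)\<bar> \<partial>M)"
    by (rule integral_abs_bound)
  also have "\<dots> \<le> (\<integral>\<omega>. L * norm (b - b') * norm (X \<omega>) \<partial>M)"
  proof (rule integral_mono)
    fix \<omega> assume "\<omega> \<in> space M"
    then have "\<bar>\<rho> (b \<bullet> X \<omega>) (Y \<omega>) - \<rho> (b' \<bullet> X \<omega>) (Y \<omega>)\<bar> \<le> L * \<bar>(b - b') \<bullet> X \<omega>\<bar>"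
      using loss_diff_le[OF Y_cases] by (simp add: inner_diff_left)
    also have "\<dots> \<le> L * (norm (b - b') * norm (X \<omega>))"
      by (intro mult_left_mono Cauchy_Schwarz_ineq2 L_nonneg)
    finally show "\<bar>\<rho> (b \<bullet> X \<omega>) (Y \<omega>) - \<rho> (b' \<bullet> X \<omega>) (Y \<omega>)\<bar> \<le> L * norm (b - b') * norm (X \<omega>)"
      by (simp add: mult.assoc)
  qed (use loss_integrable norm_integrable in auto)
  also have "\<dots> = L * (\<integral>\<omega>. norm (X \<omega>) \<partial>M) * dist b b'"
    by (simp add: dist_norm)
  finally show "dist (risk M \<rho> X Y b) (risk M \<rho> X Y b') \<le> L * (\<integral>\<omega>. norm (X \<omega>) \<partial>M) * dist b b'" .
qed (simp add: L_nonneg)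

text \<open>Continuity is what later allows the supremum over an uncountable set to be replaced by
  one over a countable dense subset.\<close>

lemma gap_continuous:
  assumes "\<omega> \<in> space M"
  shows "continuous_on UNIV (gap \<beta> \<omega>)"
proof -
  have "continuous_on UNIV (\<lambda>b. \<rho> (b \<bullet> Xs i \<omega>) (Ys i \<omega>))" if "i \<in> {1..n}" for i
    by (rule continuous_on_compose2[OF loss_continuous[OF Ys_cases[OF that assms]]])
      (auto intro!: continuous_intros)
  then show ?thesis
    unfolding gap_def emp_risk_def
    by (intro continuous_intros lipschitz_on_continuous_on[OF risk_lipschitz]) auto
qed

lemma gap_measurable [measurable]: "(\<lambda>\<omega>. gap \<beta> \<omega> b) \<in> borel_measurable M"
proof -
  have "(\<lambda>\<omega>. \<rho> (b \<bullet> Xs i \<omega>) (Ys i \<omega>)) \<in> borel_measurable M" if "i \<in> {1..n}" for i b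
    using measurable_compose[OF Zs_measurable[OF that] loss_measurable] by simp
  then show ?thesis
    unfolding gap_def emp_risk_def by (intro borel_measurable_diff borel_measurable_times
        borel_measurable_sum borel_measurable_const) auto
qed

text \<open>The finite-maximum bound is transferred from the product of the law of
  \<open>(X, Y)\<close> to the actual sample. Enlarging \<open>s\<close> to \<open>s'\<close>
  ensures a positive scale, by which the optimal \<open>t\<close> is divided, even when
  \<open>s\<close> is 0.\<close>

lemma expectation_Max_gap_le:
  assumes "finite T" and \<beta>: "\<beta> \<in> T" and l1: "\<And>b. b \<in> T \<Longrightarrow> (\<Sum>j\<in>UNIV. \<bar>(b - \<beta>) $ j\<bar>) \<le> R"
    and s': "s' > s"
  shows "(\<integral>\<^sup>+\<omega>. ennreal (MAX b\<in>T. real n * gap \<beta> \<omega> b) \<partial>M)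
    \<le> ennreal (2 * L * R * s' * sqrt (2 * real n * ln (2 * real CARD('p))))"
proof -
  define Z where "Z \<omega> = (X \<omega>, Y \<omega>)" for \<omega>
  define Zs where "Zs i \<omega> = (Xs i \<omega>, Ys i \<omega>)" for i \<omega>
  define P where "P = distr M obs_space Z"
  define g where "g b z = \<rho> (b \<bullet> fst z) (snd z) - \<rho> (\<beta> \<bullet> fst z) (snd z)"
    for b and z :: "(real ^ 'p) \<times> nat"
  have Z [measurable]: "Z \<in> measurable M obs_space"
    using rv by (simp add: Z_def[abs_def])
  have Zs: "Zs i \<in> measurable M obs_space" if "i \<in> {1..n}" for i
    using Zs_measurable[OF that] by (simp add: Zs_def[abs_def])
  have g_measurable [measurable]: "g b \<in> borel_measurable obs_space" for b
    unfolding g_def by (intro borel_measurable_diff loss_measurable)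
  have sets_P [measurable_cong]: "sets P = sets obs_space"
    by (simp add: P_def)
  have exp_measurable: "(\<lambda>z. exp (t * fst z $ j)) \<in> borel_measurable obs_space" for t j
    by (intro measurable_compose[OF fst_measurable_obs_space borel_measurable_continuous_onI]
        continuous_intros)
  have g_integrable_M: "integrable M (\<lambda>\<omega>. g b (Z \<omega>))" for b
    using loss_integrable by (simp add: g_def Z_def)
  have g_integral: "(\<integral>z. g b z \<partial>P) = risk M \<rho> X Y b - risk M \<rho> X Y \<beta>" for b
  proof -
    have "(\<integral>z. g b z \<partial>P) = (\<integral>\<omega>. g b (Z \<omega>) \<partial>M)"
      unfolding P_def by (intro integral_distr) measurable
    then show ?thesis
      using loss_integrable by (simp add: g_def Z_def risk_def)
  qed
  interpret PM: prob_space P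
    unfolding P_def by (intro prob_space_distr) measurable
  interpret PP: lipschitz_process P fst T "\<lambda>b. b - \<beta>" g L R s' \<beta>
  proof unfold_locales
    show "fst \<in> borel_measurable P"
      by measurable
    show "integrable P (\<lambda>z. exp (t * fst z $ j))" for t j
      unfolding P_def using exp_integrable[of t j]
      by (subst integrable_distr_eq) (auto simp: Z_def exp_measurable)
    show "(\<integral>z. exp (t * fst z $ j) \<partial>P) \<le> exp (t\<^sup>2 * s'\<^sup>2 / 2)" for t j
    proof -
      have "(\<integral>z. exp (t * fst z $ j) \<partial>P) = (\<integral>\<omega>. exp (t * X \<omega> $ j) \<partial>M)"
        unfolding P_def by (subst integral_distr) (auto simp: Z_def exp_measurable)
      also have "\<dots> \<le> exp (t\<^sup>2 * s\<^sup>2 / 2)"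
        by (rule exp_integral_le)
      also have "\<dots> \<le> exp (t\<^sup>2 * s'\<^sup>2 / 2)"
        using s' s_nonneg by (auto intro!: mult_left_mono power_mono)
      finally show ?thesis .
    qed
    show "integrable P (g b)" for b
      unfolding P_def using g_integrable_M by (subst integrable_distr_eq) auto
    show "g b z - g b' z \<le> L * \<bar>(b - \<beta> - (b' - \<beta>)) \<bullet> fst z\<bar>" if "z \<in> space P" for b b' z
    proof -
      have "snd z \<in> {0, 1}"
        using that by (auto simp: P_def space_obs_space)
      from loss_diff_le[OF this, of "b \<bullet> fst z" "b' \<bullet> fst z"] show ?thesis
        by (simp add: g_def inner_diff_left)
    qed
  qed (use assms L_nonneg in \<open>auto simp: g_def\<close>)
  have centred_sum: "(\<Sum>i=1..n. PP.centred b (Zs i \<omega>)) = real n * gap \<beta> \<omega> b" for b \<omega>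
    using n_pos unfolding PP.centred_def g_integral gap_def emp_risk_def g_def Zs_def
    by (simp add: sum_subtractf sum.distrib algebra_simps)
  have "(\<Pi>\<^sub>M i\<in>{1..n}. P) = (\<Pi>\<^sub>M i\<in>{1..n}. distr M obs_space (Zs i))"
    using iid unfolding iid_copies_def P_def Z_def[abs_def] Zs_def[abs_def]
    by (intro PiM_cong) auto
  \<comment> \<open>Independence enters here: the joint law of the sample is the product of its
    marginals, which all equal \<open>P\<close>.\<close>
  also have "\<dots> = distr M (\<Pi>\<^sub>M i\<in>{1..n}. obs_space) (\<lambda>\<omega>. \<lambda>i\<in>{1..n}. Zs i \<omega>)"
    using iid n_pos Zs indep_vars_iff_distr_eq_PiM'[of "{1..n}" Zs "\<lambda>_. obs_space"]
    unfolding iid_copies_def Zs_def[abs_def] by auto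
  finally have product: "(\<Pi>\<^sub>M i\<in>{1..n}. P)
      = distr M (\<Pi>\<^sub>M i\<in>{1..n}. obs_space) (\<lambda>\<omega>. \<lambda>i\<in>{1..n}. Zs i \<omega>)" .
  have centred_measurable: "PP.centred b \<in> borel_measurable obs_space" for b
    unfolding PP.centred_def by measurable
  have component_measurable:
    "(\<lambda>\<omega>. PP.centred b (\<omega> i)) \<in> borel_measurable (\<Pi>\<^sub>M i\<in>{1..n}. obs_space)"
    if "i \<in> {1..n}" for b i
    by (rule measurable_compose[OF measurable_component_singleton[where M = "\<lambda>_. obs_space", OF that]
          centred_measurable])
  have Zs_joint: "(\<lambda>\<omega>. \<lambda>i\<in>{1..n}. Zs i \<omega>) \<in> measurable M (\<Pi>\<^sub>M i\<in>{1..n}. obs_space)"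
    by (intro measurable_restrict Zs)
  have Max_measurable: "(\<lambda>\<omega>. ennreal (MAX b\<in>T. \<Sum>i=1..n. PP.centred b (\<omega> i)))
      \<in> borel_measurable (\<Pi>\<^sub>M i\<in>{1..n}. obs_space)"
    using assms(1)
    by (intro measurable_compose[OF _ measurable_ennreal] borel_measurable_Max borel_measurable_sum
        component_measurable) auto
  have "(\<integral>\<^sup>+\<omega>. ennreal (MAX b\<in>T. \<Sum>i=1..n. PP.centred b (\<omega> i)) \<partial>(\<Pi>\<^sub>M i\<in>{1..n}. P))
      = (\<integral>\<^sup>+\<omega>. ennreal (MAX b\<in>T. \<Sum>i=1..n. PP.centred b ((\<lambda>i\<in>{1..n}. Zs i \<omega>) i)) \<partial>M)"
    unfolding product using Zs_joint Max_measurable by (intro nn_integral_distr) simp_all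
  also have "\<dots> = (\<integral>\<^sup>+\<omega>. ennreal (MAX b\<in>T. real n * gap \<beta> \<omega> b) \<partial>M)"
    unfolding centred_sum[symmetric] by simp
  finally show ?thesis
    using PP.expectation_Max_le[of "{1..n}"] n_pos s' s_nonneg by simp
qed

text \<open>Markov's inequality. Adding \<open>\<beta>\<close>, where the gap vanishes, to
  \<open>T\<close> supplies the base point and makes the maximum nonnegative.\<close>

lemma prob_finite_gap_le:
  assumes "finite T" and l1: "\<And>b. b \<in> T \<Longrightarrow> (\<Sum>j\<in>UNIV. \<bar>(b - \<beta>) $ j\<bar>) \<le> R"
    and R: "R \<ge> 0" and s': "s' > s" and c: "c > 0"
  shows "c * (real n * prob {\<omega> \<in> space M. \<exists>b\<in>T. c < gap \<beta> \<omega> b})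
    \<le> 2 * L * R * s' * sqrt (2 * real n * ln (2 * real CARD('p)))"
    (is "c * (real n * prob ?E) \<le> ?B")
proof -
  define T' where "T' = insert \<beta> T"
  have T': "finite T'" "\<beta> \<in> T'" "\<And>b. b \<in> T' \<Longrightarrow> (\<Sum>j\<in>UNIV. \<bar>(b - \<beta>) $ j\<bar>) \<le> R"
    using assms by (auto simp: T'_def)
  define f where "f \<omega> = ennreal (MAX b\<in>T'. real n * gap \<beta> \<omega> b)" for \<omega>
  have f_measurable [measurable]: "f \<in> borel_measurable M"
    unfolding f_def using T' by measurable
  have E [measurable]: "?E \<in> sets M"
    using assms(1) by measurable
  have B: "0 \<le> ?B"
    using L_nonneg R s' s_nonneg
    by (intro mult_nonneg_nonneg real_sqrt_ge_zero less_imp_le[OF ln_two_CARD_pos]) auto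
  have "ennreal (c * real n) * indicator ?E \<omega> \<le> f \<omega>" if "\<omega> \<in> space M" for \<omega>
  proof (cases "\<omega> \<in> ?E")
    case True
    then obtain b where b: "b \<in> T" "c < gap \<beta> \<omega> b" by blast
    have "c * real n \<le> real n * gap \<beta> \<omega> b"
      using mult_left_mono[of c "gap \<beta> \<omega> b" "real n"] b by (simp add: mult.commute)
    also have "\<dots> \<le> (MAX b\<in>T'. real n * gap \<beta> \<omega> b)"
      using T' b by (intro Max_ge) (auto simp: T'_def)
    finally show ?thesis
      using True by (simp add: f_def ennreal_leI)
  qed simp
  then have "(\<integral>\<^sup>+\<omega>. ennreal (c * real n) * indicator ?E \<omega> \<partial>M) \<le> (\<integral>\<^sup>+\<omega>. f \<omega> \<partial>M)"
    by (intro nn_integral_mono)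
  also have "\<dots> \<le> ennreal ?B"
    unfolding f_def by (intro expectation_Max_gap_le T' s')
  finally have "ennreal (c * real n) * emeasure M ?E \<le> ennreal ?B"
    by (simp add: nn_integral_cmult_indicator)
  then have "ennreal (c * real n * prob ?E) \<le> ennreal ?B"
    using c by (simp add: emeasure_eq_measure ennreal_mult)
  then show ?thesis
    using B by (simp add: mult.assoc)
qed

text \<open>A countable dense subset of \<open>S\<close> is exhausted by finite sets, to which the
  Markov bound applies. Passing to the dense subset costs an arbitrarily small part of the level,
  hence \<open>c' < c\<close>; at the end \<open>c'\<close> tends to \<open>c\<close> and
  \<open>s'\<close> to \<open>s\<close>.\<close>

lemma prob_gap_le:
  assumes l1: "\<And>b. b \<in> S \<Longrightarrow> (\<Sum>j\<in>UNIV. \<bar>(b - \<beta>) $ j\<bar>) \<le> R"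
    and R: "R \<ge> 0" and c: "c > 0"
    and E: "AE \<omega> in M. \<omega> \<in> E \<longrightarrow> (\<exists>b\<in>S. c \<le> gap \<beta> \<omega> b)"
  shows "c * real n * prob E \<le> 2 * L * R * s * sqrt (2 * real n * ln (2 * real CARD('p)))"
proof (cases "S = {}")
  case True
  have "AE \<omega> in M. \<omega> \<in> E \<longrightarrow> \<omega> \<in> {}"
    using E True by simp
  then have "prob E \<le> 0"
    using finite_measure_mono_AE[of E "{}"] by simp
  moreover have "0 \<le> 2 * L * R * s * sqrt (2 * real n * ln (2 * real CARD('p)))"
    using L_nonneg R s_nonneg
    by (intro mult_nonneg_nonneg real_sqrt_ge_zero less_imp_le[OF ln_two_CARD_pos]) auto
  ultimately show ?thesis
    using measure_nonneg[of M E] by simp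
next
  case False
  obtain D where D: "countable D" "D \<subseteq> S" "S \<subseteq> closure D"
    using separable by blast
  have "D \<noteq> {}"
    using D False by auto
  define d where "d = from_nat_into D"
  have d: "range d = D"
    unfolding d_def using range_from_nat_into[OF \<open>D \<noteq> {}\<close> D(1)] .
  define Q where "Q = 2 * L * R * sqrt (2 * real n * ln (2 * real CARD('p)))"
  have Q: "Q \<ge> 0"
    unfolding Q_def using L_nonneg R
    by (intro mult_nonneg_nonneg real_sqrt_ge_zero less_imp_le[OF ln_two_CARD_pos]) auto
  have bound: "c' * (real n * prob E) \<le> Q * s'" if s': "s' > s" and c': "0 < c'" "c' < c" for s' c'
  proof -
    define F where "F m = {\<omega> \<in> space M. \<exists>b\<in>d ` {..m::nat}. c' < gap \<beta> \<omega> b}" for m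
    have F_sets: "range F \<subseteq> sets M"
    proof -
      have "F m \<in> sets M" for m unfolding F_def by measurable
      then show ?thesis by blast
    qed
    have "incseq F"
      by (auto simp: incseq_def F_def)
    have F_le: "c' * (real n * prob (F m)) \<le> Q * s'" for m
    proof -
      have "(\<Sum>j\<in>UNIV. \<bar>(b - \<beta>) $ j\<bar>) \<le> R" if "b \<in> d ` {..m}" for b
        using that l1 d D(2) by blast
      then show ?thesis
        using prob_finite_gap_le[of "d ` {..m}" \<beta> R s' c'] R s' c'
        by (simp add: F_def Q_def mult_ac)
    qed
    have "AE \<omega> in M. \<omega> \<in> E \<longrightarrow> \<omega> \<in> (\<Union>m. F m)"
      using E AE_space
    proof eventually_elim
      case (elim \<omega>)
      show ?case
      proof
        assume "\<omega> \<in> E"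
        then obtain b where b: "b \<in> S" "c \<le> gap \<beta> \<omega> b" using elim by blast
        \<comment> \<open>The strict inequality with \<open>c' < c\<close> makes this set an open
          neighbourhood of \<open>b\<close>, so it contains a point of the dense set.\<close>
        define U where "U = {b. c' < gap \<beta> \<omega> b}"
        have "open U"
          unfolding U_def using gap_continuous[OF elim(2)] by (intro open_Collect_less continuous_intros)
        moreover have "b \<in> U \<inter> closure D"
          using b D(3) c' by (auto simp: U_def)
        ultimately have "U \<inter> D \<noteq> {}"
          using open_Int_closure_eq_empty by blast
        then obtain m where "d m \<in> U"
          using d by blast
        then show "\<omega> \<in> (\<Union>m. F m)"
          using elim(2) by (auto simp: U_def F_def)
      qed
    qed
    then have "prob E \<le> prob (\<Union>m. F m)"
      using F_sets by (intro finite_measure_mono_AE) auto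
    then have "c' * (real n * prob E) \<le> c' * (real n * prob (\<Union>m. F m))"
      using c' by (intro mult_left_mono) auto
    also have "\<dots> \<le> Q * s'"
    proof (rule LIMSEQ_le_const2)
      show "(\<lambda>m. c' * (real n * prob (F m))) \<longlonglongrightarrow> c' * (real n * prob (\<Union>m. F m))"
        by (intro tendsto_intros finite_Lim_measure_incseq F_sets \<open>incseq F\<close>)
    qed (use F_le in auto)
    finally show ?thesis .
  qed
  have "c * real n * prob E \<le> Q * s"
  proof (rule field_le_epsilon)
    fix e :: real assume e: "e > 0"
    \<comment> \<open>The excess of the bound is then \<open>e * Q / (Q + 1)\<close>, which is at
      most \<open>e\<close>; the added 1 covers \<open>Q = 0\<close>.\<close>
    define s' where "s' = s + e / (Q + 1)"
    have s': "s' > s" using e Q by (simp add: s'_def)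
    have "c * real n * prob E \<le> Q * s'"
    proof (rule field_le_mult_one_interval)
      fix z :: real assume z: "0 < z" "z < 1"
      have "(z * c) * (real n * prob E) \<le> Q * s'"
        using z c by (intro bound s') auto
      then show "z * (c * real n * prob E) \<le> Q * s'"
        by (simp add: mult.assoc)
    qed
    also have "\<dots> = Q * s + e * (Q / (Q + 1))"
      by (simp add: s'_def distrib_left)
    also have "\<dots> \<le> Q * s + e"
      using e Q by (simp add: pos_divide_le_eq)
    finally show "c * real n * prob E \<le> Q * s + e" .
  qed
  then show ?thesis
    by (simp add: Q_def mult_ac)
qed

end

section \<open>Sparsity, convexity and the minimum over models\<close>

text \<open>Cauchy-Schwarz on \<open>w\<close> against the constant 1. This is the source of the
  factor \<open>sqrt k\<close>.\<close>

lemma l1_le_sqrt_card: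
  fixes v :: "real ^ 'p"
  assumes "supp v \<subseteq> w" "card w \<le> k" "norm v \<le> r"
  shows "(\<Sum>j\<in>UNIV. \<bar>v $ j\<bar>) \<le> sqrt (real k) * r"
proof -
  have "(\<Sum>j\<in>UNIV. \<bar>v $ j\<bar>) = (\<Sum>j\<in>w. \<bar>v $ j\<bar> * \<bar>1\<bar>)"
    using assms(1) by (intro sum.mono_neutral_cong_right) (auto simp: supp_def)
  also have "\<dots> \<le> L2_set (\<lambda>j. v $ j) w * L2_set (\<lambda>_. 1) w"
    by (rule L2_set_mult_ineq)
  also have "\<dots> \<le> r * sqrt (real k)"
  proof (intro mult_mono)
    have "L2_set (\<lambda>j. v $ j) w \<le> norm v"
      unfolding norm_vec_def by (simp add: L2_set_def sum_mono2)
    then show "L2_set (\<lambda>j. v $ j) w \<le> r"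
      using assms(3) by simp
    show "0 \<le> r"
      using assms(3) norm_ge_zero order_trans by blast
  qed (use assms(2) in \<open>auto simp: L2_set_def\<close>)
  finally show ?thesis by (simp add: mult.commute)
qed

lemma supp_segment_subset:
  "supp b \<subseteq> w \<Longrightarrow> supp b' \<subseteq> w \<Longrightarrow> supp ((1 - t) *\<^sub>R b + t *\<^sub>R b') \<subseteq> w"
  by (auto simp: supp_def subset_iff) (metis add_0 mult_zero_right)

lemma emp_risk_convex:
  fixes Xs :: "nat \<Rightarrow> 'a \<Rightarrow> real ^ 'p"
  assumes convex: "\<And>y. y \<in> {0, 1} \<Longrightarrow> convex_on UNIV (\<lambda>t. \<rho> t y)"
    and Ys: "\<And>i. i \<in> {1..n} \<Longrightarrow> Ys i \<omega> \<in> {0, 1}"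
  shows "convex_on UNIV (emp_risk \<rho> n Xs Ys \<omega>)"
proof (rule convex_onI)
  fix t :: real and b b' :: "real ^ 'p"
  assume t: "0 < t" "t < 1"
  have "(\<Sum>i=1..n. \<rho> (((1 - t) *\<^sub>R b + t *\<^sub>R b') \<bullet> Xs i \<omega>) (Ys i \<omega>))
      \<le> (\<Sum>i=1..n. (1 - t) * \<rho> (b \<bullet> Xs i \<omega>) (Ys i \<omega>) + t * \<rho> (b' \<bullet> Xs i \<omega>) (Ys i \<omega>))"
  proof (rule sum_mono)
    fix i assume "i \<in> {1..n}"
    then show "\<rho> (((1 - t) *\<^sub>R b + t *\<^sub>R b') \<bullet> Xs i \<omega>) (Ys i \<omega>)
        \<le> (1 - t) * \<rho> (b \<bullet> Xs i \<omega>) (Ys i \<omega>) + t * \<rho> (b' \<bullet> Xs i \<omega>) (Ys i \<omega>)"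
      using convex_onD[OF convex[OF Ys], of i t "b \<bullet> Xs i \<omega>" "b' \<bullet> Xs i \<omega>"] t
      by (simp add: inner_add_left)
  qed
  then have "1 / real n * (\<Sum>i=1..n. \<rho> (((1 - t) *\<^sub>R b + t *\<^sub>R b') \<bullet> Xs i \<omega>) (Ys i \<omega>))
      \<le> 1 / real n * (\<Sum>i=1..n. (1 - t) * \<rho> (b \<bullet> Xs i \<omega>) (Ys i \<omega>) + t * \<rho> (b' \<bullet> Xs i \<omega>) (Ys i \<omega>))"
    by (intro mult_left_mono) auto
  then show "emp_risk \<rho> n Xs Ys \<omega> ((1 - t) *\<^sub>R b + t *\<^sub>R b')
      \<le> (1 - t) * emp_risk \<rho> n Xs Ys \<omega> b + t * emp_risk \<rho> n Xs Ys \<omega> b'"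
    unfolding emp_risk_def sum.distrib sum_distrib_left[symmetric] distrib_left
    by (simp only: mult.left_commute)
qed simp

text \<open>The infimum over the empty set is infinite, so a real upper bound forces
  \<open>A\<close> to be nonempty; finiteness then makes the infimum attained.\<close>

lemma INF_ereal_leE:
  assumes "finite A" "(INF w\<in>A. ereal (f w)) \<le> ereal c"
  obtains w where "w \<in> A" "f w \<le> c"
proof -
  have "A \<noteq> {}"
    using assms(2) by (auto simp: top_ereal_def)
  then have "(INF w\<in>A. ereal (f w)) \<in> (\<lambda>w. ereal (f w)) ` A"
    using assms(1) by (simp add: cInf_eq_Min)
  then show thesis
    using assms(2) that by auto
qed

lemma ln_double_le: "ln (2 * real p) \<le> 2 * ln (real (max p 2))" if "p \<ge> 1"
proof -
  have "2 * real p \<le> (real (max p 2))\<^sup>2"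
    unfolding power2_eq_square using that by (intro mult_mono) auto
  then have "ln (2 * real p) \<le> ln ((real (max p 2))\<^sup>2)"
    using that by (intro ln_mono) auto
  then show ?thesis
    by (simp add: ln_realpow)
qed

section \<open>Reduction of the GIC event to a large gap, and the constants\<close>

theorem theorem2:
  fixes M :: "'a measure"
    and X :: "'a \<Rightarrow> real ^ 'p" and Y :: "'a \<Rightarrow> nat"
    and Xs :: "nat \<Rightarrow> 'a \<Rightarrow> real ^ 'p" and Ys :: "nat \<Rightarrow> 'a \<Rightarrow> nat"
    and \<rho> :: "real \<Rightarrow> nat \<Rightarrow> real"
    and \<beta>star :: "real ^ 'p"
    and \<beta>hat :: "'p set \<Rightarrow> 'a \<Rightarrow> real ^ 'p"
    and \<M> :: "'a \<Rightarrow> 'p set set"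
    and \<sigma> :: "'p \<Rightarrow> real"
    and n k :: nat
    and a L \<epsilon> \<theta> r :: real
  assumes prob: "prob_space M"
    and n_pos: "n \<ge> 1"
    and rv: "(\<lambda>\<omega>. (X \<omega>, Y \<omega>)) \<in> measurable M obs_space"
    and iid: "iid_copies M obs_space (\<lambda>\<omega>. (X \<omega>, Y \<omega>)) (\<lambda>i \<omega>. (Xs i \<omega>, Ys i \<omega>)) {1..n}"
    and nondegenerate: "\<forall>b. b \<noteq> 0 \<longrightarrow> \<not> (\<exists>c. AE \<omega> in M. b \<bullet> X \<omega> = c)"
    and \<beta>star_min: "is_arg_min (risk M \<rho> X Y) (\<lambda>_. True) \<beta>star"
    and \<beta>star_unique: "\<forall>b. is_arg_min (risk M \<rho> X Y) (\<lambda>_. True) b \<longrightarrow> b = \<beta>star"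
    and k_pos: "k \<ge> 1"
    and a_pos: "a > 0"
    and \<M>_random: "\<M> \<in> measurable M (count_space UNIV)"
    and \<M>_models: "AE \<omega> in M. supp \<beta>star \<in> \<M> \<omega> \<and> (\<forall>w\<in>\<M> \<omega>. card w \<le> k)"
    and \<beta>hat_random: "\<forall>w. \<beta>hat w \<in> borel_measurable M"
    and \<beta>hat_min: "AE \<omega> in M. \<forall>w\<in>\<M> \<omega>.
      is_arg_min (emp_risk \<rho> n Xs Ys \<omega>) (\<lambda>b. supp b \<subseteq> w) (\<beta>hat w \<omega>)"
    and L_pos: "L > 0"
    and \<rho>_convex: "\<forall>y\<in>{0, 1}. convex_on UNIV (\<lambda>t. \<rho> t y)"
    and \<rho>_lipschitz: "\<forall>y\<in>{0, 1}. L-lipschitz_on UNIV (\<lambda>t. \<rho> t y)"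
    and \<sigma>_nonneg: "\<forall>j. \<sigma> j \<ge> 0"
    and subgaussian: "\<forall>j. subg M (\<lambda>\<omega>. X \<omega> $ j) ((\<sigma> j)\<^sup>2)"
    and \<epsilon>_pos: "\<epsilon> > 0" and \<theta>_pos: "\<theta> > 0"
    and margin: "\<forall>w. card w \<le> k \<longrightarrow>
      (\<forall>b. supp b \<subseteq> w \<and> norm (b - \<beta>star) \<le> \<epsilon> \<longrightarrow>
        risk M \<rho> X Y b - risk M \<rho> X Y \<beta>star \<ge> \<theta> * (norm (b - \<beta>star))\<^sup>2)"
    and r_pos: "0 < r" and r_less: "r < \<epsilon>"
  shows "\<P>(\<omega> in M.
           (INF w\<in>{w \<in> \<M> \<omega>. supp \<beta>star \<subset> w}. ereal (GIC \<rho> n Xs Ys a \<beta>hat \<omega> w))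
             \<le> ereal (GIC \<rho> n Xs Ys a \<beta>hat \<omega> (supp \<beta>star)))
         \<le> 8 * L * sqrt (real k) * (MAX j. \<sigma> j) * sqrt (ln (real (max CARD('p) 2))) / sqrt (real n)
             * (r * real n / a + 4 / (\<theta> * r))"
proof -
  define s where "s = (MAX j. \<sigma> j)"
  have \<sigma>_le: "\<sigma> j \<le> s" for j
    unfolding s_def by (intro Max_ge) auto
  have s: "s \<ge> 0"
    using \<sigma>_nonneg \<sigma>_le order_trans by blast
  interpret regression_sample M X Y Xs Ys \<rho> n L s
  proof (intro regression_sample.intro regression_sample_axioms.intro prob n_pos rv iid s)
    show "integrable M (\<lambda>\<omega>. exp (t * X \<omega> $ j))" for t j
      using subgaussian by (auto simp: subg_def)
    show "(\<integral>\<omega>. exp (t * X \<omega> $ j) \<partial>M) \<le> exp (t\<^sup>2 * s\<^sup>2 / 2)" for t j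
    proof -
      have "(\<integral>\<omega>. exp (t * X \<omega> $ j) \<partial>M) \<le> exp (t\<^sup>2 * (\<sigma> j)\<^sup>2 / 2)"
        using subgaussian by (auto simp: subg_def)
      also have "\<dots> \<le> exp (t\<^sup>2 * s\<^sup>2 / 2)"
        using \<sigma>_nonneg \<sigma>_le by (auto intro!: mult_left_mono power_mono)
      finally show ?thesis .
    qed
  qed (use \<rho>_lipschitz in auto)
  define R where "R = sqrt (real k) * r"
  \<comment> \<open>Requiring \<open>w\<close> to contain the support of \<open>\<beta>star\<close>
    as well puts \<open>b - \<beta>star\<close> into a single model of size at most
    \<open>k\<close>, so its l1 norm is at most \<open>sqrt k * r\<close>.\<close>
  define S where "S = {b. \<exists>w. supp \<beta>star \<subseteq> w \<and> card w \<le> k \<and> supp b \<subseteq> w \<and> norm (b - \<beta>star) \<le> r}"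
  \<comment> \<open>The first entry is the gap forced when the estimator lies within distance
    \<open>r\<close>, the second the gap forced when it lies farther away.\<close>
  define c where "c = min (a / real n) (\<theta> * r\<^sup>2)"
  define p where "p = real (max CARD('p) 2)"
  define E where "E = {\<omega> \<in> space M.
    (INF w\<in>{w \<in> \<M> \<omega>. supp \<beta>star \<subset> w}. ereal (GIC \<rho> n Xs Ys a \<beta>hat \<omega> w))
      \<le> ereal (GIC \<rho> n Xs Ys a \<beta>hat \<omega> (supp \<beta>star))}"
  have n: "real n > 0"
    using n_pos by simp
  have c: "c > 0"
    using a_pos n \<theta>_pos r_pos by (simp add: c_def)
  have l1: "(\<Sum>j\<in>UNIV. \<bar>(b - \<beta>star) $ j\<bar>) \<le> R" if b: "b \<in> S" for b
  proof -
    obtain w where w: "supp \<beta>star \<subseteq> w" "card w \<le> k" "supp b \<subseteq> w" "norm (b - \<beta>star) \<le> r"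
      using b by (auto simp: S_def)
    have "supp (b - \<beta>star) \<subseteq> w"
      using w(1,3) by (auto simp: supp_def subset_iff) metis
    then show ?thesis
      unfolding R_def using w by (intro l1_le_sqrt_card)
  qed
  have event: "AE \<omega> in M. \<omega> \<in> E \<longrightarrow> (\<exists>b\<in>S. c \<le> gap \<beta>star \<omega> b)"
    using \<M>_models \<beta>hat_min AE_space
  proof eventually_elim
    case (elim \<omega>)
    let ?Rn = "emp_risk \<rho> n Xs Ys \<omega>"
    show ?case
    proof
      assume "\<omega> \<in> E"
      then obtain w where w: "w \<in> \<M> \<omega>" "supp \<beta>star \<subset> w"
        and gic: "GIC \<rho> n Xs Ys a \<beta>hat \<omega> w \<le> GIC \<rho> n Xs Ys a \<beta>hat \<omega> (supp \<beta>star)"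
        unfolding E_def by (auto elim!: INF_ereal_leE[rotated])
      define b where "b = \<beta>hat w \<omega>"
      have card_w: "card w \<le> k"
        using elim w by blast
      have supp_b: "supp b \<subseteq> w"
        using elim w unfolding b_def is_arg_min_def by blast
      \<comment> \<open>\<open>\<beta>star\<close> is a competitor in its own support, so the fit
        there has no larger empirical risk.\<close>
      have "?Rn (\<beta>hat (supp \<beta>star) \<omega>) \<le> ?Rn \<beta>star"
        using elim by (auto simp: is_arg_min_linorder)
      then have "real n * ?Rn (\<beta>hat (supp \<beta>star) \<omega>) \<le> real n * ?Rn \<beta>star"
        by (simp add: mult_left_mono)
      \<comment> \<open>A proper superset has at least one more element, which costs one full
        penalty \<open>a\<close>.\<close>
      moreover have "a * (real (card (supp \<beta>star)) + 1) \<le> a * real (card w)"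
        using psubset_card_mono[OF _ w(2)] a_pos by (intro mult_left_mono) auto
      ultimately have "real n * ?Rn b + a \<le> real n * ?Rn \<beta>star"
        using gic unfolding GIC_def b_def by (simp add: distrib_left)
      then have drop: "?Rn b + a / real n \<le> ?Rn \<beta>star"
        using n by (simp add: field_simps)
      show "\<exists>b\<in>S. c \<le> gap \<beta>star \<omega> b"
      proof (cases "norm (b - \<beta>star) \<le> r")
        case True
        have "risk M \<rho> X Y \<beta>star \<le> risk M \<rho> X Y b"
          using \<beta>star_min by (auto simp: is_arg_min_linorder)
        then have "a / real n \<le> gap \<beta>star \<omega> b"
          using drop unfolding gap_def by linarith
        moreover have "b \<in> S"
          using True w(2) card_w supp_b by (auto simp: S_def)
        ultimately show ?thesis
          unfolding c_def by (meson min.coboundedI1)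
      next
        case False
        \<comment> \<open>\<open>t\<close> is chosen so that \<open>b'\<close> lies at distance
          exactly \<open>r\<close>. Because the empirical risk at \<open>b\<close> is below that at
          \<open>\<beta>star\<close>, convexity keeps it from exceeding that value at
          \<open>b'\<close>.\<close>
        define t where "t = r / norm (b - \<beta>star)"
        define b' where "b' = (1 - t) *\<^sub>R \<beta>star + t *\<^sub>R b"
        have "norm (b - \<beta>star) > 0"
          using False r_pos by linarith
        then have t: "0 < t" "t < 1"
          using False r_pos by (auto simp: t_def)
        have "b' - \<beta>star = t *\<^sub>R (b - \<beta>star)"
          by (simp add: b'_def algebra_simps)
        then have norm_b': "norm (b' - \<beta>star) = r"
          using t False r_pos by (auto simp: t_def)
        have supp_b': "supp b' \<subseteq> w"
          unfolding b'_def using w(2) supp_b by (intro supp_segment_subset) auto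
        have "convex_on UNIV ?Rn"
          using \<rho>_convex Ys_cases elim by (intro emp_risk_convex) auto
        then have "?Rn b' \<le> (1 - t) * ?Rn \<beta>star + t * ?Rn b"
          unfolding b'_def using t by (intro convex_onD) auto
        also have "\<dots> \<le> (1 - t) * ?Rn \<beta>star + t * ?Rn \<beta>star"
        proof -
          have "0 < a / real n"
            using a_pos n by simp
          then show ?thesis
            using drop t by (intro add_left_mono mult_left_mono) auto
        qed
        finally have "?Rn b' \<le> ?Rn \<beta>star"
          by (simp add: algebra_simps)
        \<comment> \<open>\<open>r < \<epsilon>\<close> places \<open>b'\<close> in the range of the
          margin condition for the model \<open>w\<close>.\<close>
        moreover have "\<theta> * r\<^sup>2 \<le> risk M \<rho> X Y b' - risk M \<rho> X Y \<beta>star"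
          using margin card_w supp_b' norm_b' r_less by fastforce
        ultimately have "\<theta> * r\<^sup>2 \<le> gap \<beta>star \<omega> b'"
          unfolding gap_def by linarith
        moreover have "b' \<in> S"
          using norm_b' supp_b' card_w w(2) by (auto simp: S_def)
        ultimately show ?thesis
          unfolding c_def by (meson min.coboundedI2)
      qed
    qed
  qed
  have "R \<ge> 0"
    using r_pos by (simp add: R_def)
  have "c * real n * prob E \<le> 2 * L * R * s * sqrt (2 * real n * ln (2 * real CARD('p)))"
    by (rule prob_gap_le[OF l1 \<open>R \<ge> 0\<close> c event])
  \<comment> \<open>Replacing \<open>2 * CARD('p)\<close> in the logarithm by
    \<open>max CARD('p) 2\<close> costs a factor 2; with the 2 already under the root this leaves a
    factor 2 outside.\<close>
  also have "\<dots> \<le> 2 * L * R * s * (2 * (sqrt (real n) * sqrt (ln p)))"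
  proof (intro mult_left_mono)
    have "2 * real n * ln (2 * real CARD('p)) \<le> 2 * real n * (2 * ln p)"
      unfolding p_def using n by (intro mult_left_mono ln_double_le) (auto simp: Suc_le_eq)
    then have "sqrt (2 * real n * ln (2 * real CARD('p))) \<le> sqrt (2\<^sup>2 * (real n * ln p))"
      by (intro real_sqrt_le_mono) simp
    then show "sqrt (2 * real n * ln (2 * real CARD('p))) \<le> 2 * (sqrt (real n) * sqrt (ln p))"
      by (simp only: real_sqrt_mult real_sqrt_abs abs_numeral)
  qed (use L_pos \<open>R \<ge> 0\<close> s in auto)
  finally have "c * real n * prob E \<le> 4 * L * R * s * sqrt (ln p) * sqrt (real n)"
    by (simp add: mult_ac)
  then have "prob E \<le> 4 * L * R * s * sqrt (ln p) * sqrt (real n) / (c * real n)"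
    using c n by (simp add: pos_le_divide_eq mult_ac)
  also have "\<dots> = 4 * L * R * s * sqrt (ln p) / sqrt (real n) * (1 / c)"
  proof -
    have "B * sqrt (real n) / (c * real n) = B * (sqrt (real n) / real n) * (1 / c)" for B
      by simp
    then show ?thesis
      unfolding sqrt_divide_self_eq[OF of_nat_0_le_iff] by (simp only: divide_inverse)
  qed
  also have "\<dots> \<le> 4 * L * R * s * sqrt (ln p) / sqrt (real n) * (real n / a + 1 / (\<theta> * r\<^sup>2))"
  proof (intro mult_left_mono)
    \<comment> \<open>The reciprocal of a minimum of positive numbers is at most the sum of their
      reciprocals.\<close>
    show "1 / c \<le> real n / a + 1 / (\<theta> * r\<^sup>2)"
      using a_pos n \<theta>_pos r_pos unfolding c_def by (simp add: min_def)
  qed (use L_pos \<open>R \<ge> 0\<close> s in \<open>auto simp: p_def\<close>)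
  also have "\<dots> = 4 * L * sqrt (real k) * s * sqrt (ln p) / sqrt (real n) * (r * real n / a + 1 / (\<theta> * r))"
  proof -
    have "r * real n / a + 1 / (\<theta> * r) = r * (real n / a + 1 / (\<theta> * r\<^sup>2))"
      using r_pos by (simp add: distrib_left power2_eq_square)
    then show ?thesis
      by (simp only: R_def times_divide_eq_left times_divide_eq_right mult_ac)
  qed
  \<comment> \<open>The argument yields the constants 4 and 1; they are enlarged here to the stated
    8 and 4.\<close>
  also have "\<dots> \<le> 8 * L * sqrt (real k) * s * sqrt (ln p) / sqrt (real n) * (r * real n / a + 4 / (\<theta> * r))"
    using L_pos s r_pos \<theta>_pos a_pos n
    by (intro mult_mono divide_right_mono mult_right_mono add_mono)
      (auto simp: p_def divide_right_mono)
  finally show ?thesis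
    unfolding E_def s_def p_def .
qed
end
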